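(* Let $P\in\mathbb{R}^{n\times n}$ be a stochastic, irreducible and aperiodic matrix with stationary distribution $\pi$, and suppose that the Markov chain with transition matrix $P$ is reversible, i.e. $\pi_iP_{ij}=\pi_jP_{ji}$ for all $i,j$. Let $\Sigma_w$ be the covariance matrix of the noise in the noisy consensus iteration $x(t+1)=Px(t)+w(t)$, and let $\delta_{\rm ss}(P,\Sigma_w)$ be the weighted steady-state disagreement of this iteration. Then $$\delta_{\rm ss}(P,\Sigma_w)=\pi^T H_{P^2}D_\pi\Sigma_wD_\pi\mathbf{1}-\mathrm{Tr}\left(H_{P^2}D_\pi\Sigma_wD_\pi\right).$$
   Context: $\mathbf{1}\in\mathbb{R}^n$ is the all-ones vector. The stationary distribution $\pi$ of $P$ is the unique vector with $\pi^TP=\pi^T$, $\sum_i\pi_i=1$; $D_\pi=\mathrm{diag}(\pi_1,\dots,\pi_n)$. Noisy consensus: $x(t+1)=Px(t)+w(t)$, $t=0,1,2,\dots$, where $x(0)\in\mathbb{R}^n$ is an arbitrary deterministic vector and $w(0),w(1),\dots$ are i.i.d. (in time) zero-mean random vectors in $\mathbb{R}^n$ with (finite, arbitrary) covariance matrix $\Sigma_w=E[w(t)w(t)^T]$. Weighted average vector: $\overline{x}(t)=\left(\sum_{i=1}^n\pi_ix_i(t)\right)\mathbf{1}$. Error vector: $e(t)=x(t)-\overline{x}(t)$. Weighted disagreement: $\delta(t)=\sum_{i=1}^n\pi_iE[e_i^2(t)]$. Weighted steady-state disagreement: $\delta_{\rm ss}(P,\Sigma_w)=\limsup_{t\to\infty}\delta(t)$.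 Hitting times: for a stochastic matrix $M$, $H_M(i\to j)$ is the expected time until the Markov chain with transition matrix $M$ started at $i$ visits $j$ for the first time, with the convention $H_M(i\to i)=0$; $H_M$ is the matrix whose $(i,j)$ entry is $H_M(i\to j)$. *)

theory Defs
  imports "HOL-Probability.Probability"
begin

section \<open>Stochastic matrices\<close>

definition stochastic :: "real^'n^'n \<Rightarrow> bool" where
  "stochastic P \<longleftrightarrow> (\<forall>i j. 0 \<le> P $ i $ j) \<and> (\<forall>i. (\<Sum>j\<in>UNIV. P $ i $ j) = 1)"

definition matrix_power :: "real^'n^'n \<Rightarrow> nat \<Rightarrow> real^'n^'n" where
  "matrix_power P k = (((**) P) ^^ k) (mat 1)"

definition irreducible_matrix :: "real^'n^'n \<Rightarrow> bool" where
  "irreducible_matrix P \<longleftrightarrow> (\<forall>i j. \<exists>k. 0 < matrix_power P k $ i $ j)"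

definition aperiodic_matrix :: "real^'n^'n \<Rightarrow> bool" where
  "aperiodic_matrix P \<longleftrightarrow> (\<forall>i. Gcd {k. 0 < k \<and> 0 < matrix_power P k $ i $ i} = 1)"

definition stationary_distribution :: "real^'n^'n \<Rightarrow> real^'n \<Rightarrow> bool" where
  "stationary_distribution P \<pi> \<longleftrightarrow> \<pi> v* P = \<pi> \<and> (\<Sum>i\<in>UNIV. \<pi> $ i) = 1"

definition reversible_wrt :: "real^'n^'n \<Rightarrow> real^'n \<Rightarrow> bool" where
  "reversible_wrt P \<pi> \<longleftrightarrow> (\<forall>i j. \<pi> $ i * P $ i $ j = \<pi> $ j * P $ j $ i)"

definition diag_matrix :: "real^'n \<Rightarrow> real^'n^'n" where
  "diag_matrix v = (\<chi> i j. if i = j then v $ i else 0)"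


section \<open>Hitting times\<close>

text \<open>
  The kernel gives the law of the state at time \<open>t\<close> given the states at times
  \<open>0, \<dots>, t - 1\<close>: a point mass at \<open>i\<close> for \<open>t = 0\<close>, and row \<open>\<omega> (t - 1)\<close> of \<open>M\<close> for \<open>t > 0\<close>.
  The Ionescu-Tulcea limit of these kernels is the law on trajectories \<open>nat \<Rightarrow> 'n\<close> of
  the Markov chain with transition matrix \<open>M\<close> started at \<open>i\<close>;
  see lemma \<open>emeasure_markov_chain_cylinder\<close> below.
\<close>

definition chain_kernel ::
  "real^'n^'n \<Rightarrow> 'n \<Rightarrow> nat \<Rightarrow> (nat \<Rightarrow> 'n) \<Rightarrow> 'n measure" where
  "chain_kernel M i t \<omega> =
     point_measure UNIV
       (\<lambda>j. if t = 0 then indicator {i} j else ennreal (M $ \<omega> (t - 1) $ j))"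

definition markov_chain :: "real^'n^'n \<Rightarrow> 'n \<Rightarrow> (nat \<Rightarrow> 'n) measure" where
  "markov_chain M i =
     projective_family.lim UNIV
       (Ionescu_Tulcea.CI (chain_kernel M i) (\<lambda>_. count_space UNIV)) (\<lambda>_. count_space UNIV)"

text \<open>First visit to \<open>j\<close>, time 0 included; it is \<open>\<infinity>\<close> if \<open>j\<close> is never visited.\<close>

definition first_visit :: "'n \<Rightarrow> (nat \<Rightarrow> 'n) \<Rightarrow> enat" where
  "first_visit j \<omega> = (INF t \<in> {t. \<omega> t = j}. enat t)"

definition hitting_time :: "real^'n^'n \<Rightarrow> 'n \<Rightarrow> 'n \<Rightarrow> ennreal" where
  "hitting_time M i j = (\<integral>\<^sup>+ \<omega>. ennreal_of_enat (first_visit j \<omega>) \<partial>markov_chain M i)"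

text \<open>
  Expected hitting times are finite for irreducible \<open>M\<close>; otherwise \<open>enn2real\<close> sends an
  infinite one to 0.
\<close>

definition hitting_matrix :: "real^'n^'n \<Rightarrow> real^'n^'n" where
  "hitting_matrix M = (\<chi> i j. enn2real (hitting_time M i j))"

lemma Ionescu_Tulcea_chain_kernel:
  fixes M :: "real^'n^'n"
  assumes "stochastic M"
  shows "Ionescu_Tulcea (chain_kernel M i) (\<lambda>_. count_space UNIV)"
proof (rule Ionescu_Tulcea.intro)
  have prob: "prob_space (chain_kernel M i t \<omega>)" for t \<omega>
  proof (rule prob_spaceI)
    have "(\<Sum>j\<in>UNIV. ennreal (M $ \<omega> (t - 1) $ j)) = 1"
      using assms by (subst sum_ennreal) (auto simp: stochastic_def)
    then show "emeasure (chain_kernel M i t \<omega>) (space (chain_kernel M i t \<omega>)) = 1"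
      by (cases t) (simp_all add: chain_kernel_def space_point_measure
            emeasure_point_measure_finite indicator_def)
  qed
  show "prob_space (chain_kernel M i t \<omega>)" for t \<omega>
    by (rule prob)
  show "chain_kernel M i t \<in> measurable (PiM {0..<t} (\<lambda>_. count_space UNIV))
      (subprob_algebra (count_space UNIV))" for t
  proof (cases t)
    case 0
    then have "chain_kernel M i t = (\<lambda>_. chain_kernel M i 0 undefined)"
      by (auto simp: chain_kernel_def)
    moreover have "chain_kernel M i 0 undefined \<in> space (subprob_algebra (count_space UNIV))"
      using prob[THEN prob_space_imp_subprob_space]
      by (simp only: space_subprob_algebra mem_Collect_eq) (simp add: chain_kernel_def sets_point_measure)
    ultimately show ?thesis by simp
  next
    case (Suc u)
    then have "chain_kernel M i t =
        (\<lambda>s. chain_kernel M i t (\<lambda>_. s)) \<circ> (\<lambda>\<omega>. \<omega> u)"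
      by (auto simp: chain_kernel_def)
    moreover have "(\<lambda>s. chain_kernel M i t (\<lambda>_. s)) \<in>
        measurable (count_space UNIV) (subprob_algebra (count_space UNIV))"
      using prob[THEN prob_space_imp_subprob_space]
      by (simp only: measurable_count_space_eq1 Pi_iff space_subprob_algebra mem_Collect_eq)
         (simp add: chain_kernel_def sets_point_measure)
    moreover have "(\<lambda>\<omega>. \<omega> u) \<in>
        measurable (PiM {0..<t} (\<lambda>_. count_space UNIV)) (count_space (UNIV :: 'n set))"
      using Suc by (intro measurable_component_singleton) auto
    ultimately show ?thesis by (metis measurable_comp)
  qed
qed

lemma emeasure_markov_chain_cylinder:
  fixes M :: "real^'n^'n"
  assumes "stochastic M"
  shows "emeasure (markov_chain M i) {\<omega>. \<forall>k\<le>t. \<omega> k = s k} =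
    (if s 0 = i then ennreal (\<Prod>k<t. M $ s k $ s (Suc k)) else 0)"
proof -
  let ?N = "\<lambda>_::nat. count_space (UNIV :: 'n set)"
  interpret IT: Ionescu_Tulcea "chain_kernel M i" ?N
    by (rule Ionescu_Tulcea_chain_kernel[OF assms])
  let ?S = "\<lambda>n. {restrict s {0..<n}}"
  have S_eq: "?S n = PiE {0..<n} (\<lambda>k. {s k})" for n
    by (auto simp: PiE_iff extensional_def restrict_def)
  have S_sets[measurable]: "?S n \<in> sets (PiM {0..<n} ?N)" for n
    unfolding S_eq by (rule sets_PiM_I_finite) auto
  have C: "emeasure (IT.C 0 (Suc n) (\<lambda>_. undefined)) (?S (Suc n)) =
      (if s 0 = i then ennreal (\<Prod>k<n. M $ s k $ s (Suc k)) else 0)" for n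
  proof -
    have step: "emeasure (IT.C 0 (Suc n) (\<lambda>_. undefined)) (?S (Suc n)) =
      emeasure (IT.C 0 n (\<lambda>_. undefined)) (?S n) *
      (if n = 0 then indicator {i} (s n) else ennreal (M $ s (n - 1) $ s n))" for n
    proof -
      let ?c = "(if n = 0 then indicator {i} (s n) else ennreal (M $ s (n - 1) $ s n))"
      have u: "(\<lambda>_. undefined) \<in> space (PiM {0..<0} ?N)"
        by (simp add: space_PiM)
      have sp: "space (IT.C 0 n (\<lambda>_. undefined)) = space (PiM {0..<n} ?N)"
        using IT.space_C[OF u, of n] by simp
      have se: "sets (IT.C 0 n (\<lambda>_. undefined)) = sets (PiM {0..<n} ?N)"
        using IT.sets_C[OF u, of n] by simp
      have "emeasure (IT.C 0 (Suc n) (\<lambda>_. undefined)) (?S (Suc n)) =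
        (\<integral>\<^sup>+x. emeasure (IT.eP n x) (?S (Suc n)) \<partial>IT.C 0 n (\<lambda>_. undefined))"
        using IT.measurable_eP[of n] S_sets[of "Suc n"]
        by (simp add: emeasure_bind[where N="PiM {0..<Suc n} ?N"] sp measurable_cong_sets[OF se refl])
      also have "\<dots> = (\<integral>\<^sup>+x. ?c * indicator (?S n) x \<partial>IT.C 0 n (\<lambda>_. undefined))"
      proof (rule nn_integral_cong)
        fix x assume "x \<in> space (IT.C 0 n (\<lambda>_. undefined))"
        then have x: "x \<in> space (PiM {0..<n} ?N)" by (simp add: sp)
        have "(\<lambda>y. x(n := y)) -` ?S (Suc n) \<inter> space (count_space UNIV) =
          (if x = restrict s {0..<n} then {s n} else {})"
        proof -
          have "x(n := y) = restrict s {0..<Suc n} \<longleftrightarrow> x = restrict s {0..<n} \<and> y = s n" for y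
            using x by (auto simp: space_PiM PiE_iff extensional_def fun_eq_iff restrict_def
                less_Suc_eq)
          then show ?thesis by auto
        qed
        then have "emeasure (IT.eP n x) (?S (Suc n)) =
            emeasure (chain_kernel M i n x) (if x = restrict s {0..<n} then {s n} else {})"
          using IT.emeasure_eP[OF x S_sets] by simp
        also have "\<dots> = ?c * indicator (?S n) x"
          by (auto simp: chain_kernel_def emeasure_point_measure_finite)
        finally show "emeasure (IT.eP n x) (?S (Suc n)) = ?c * indicator (?S n) x" .
      qed
      also have "\<dots> = ?c * emeasure (IT.C 0 n (\<lambda>_. undefined)) (?S n)"
        by (rule nn_integral_cmult_indicator) (simp only: se S_sets)
      finally show ?thesis by (simp only: mult.commute)
    qed
    show ?thesis
    proof (induction n)
      case 0
      have "emeasure (IT.C 0 0 (\<lambda>_. undefined)) (?S 0) = 1"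
        using S_sets[of 0] by (simp add: restrict_def)
      then show ?case unfolding step[of 0] by (auto simp del: IT.C.simps)
    next
      case (Suc n)
      have "0 \<le> M $ a $ b" for a b
        using assms by (simp add: stochastic_def)
      then show ?case
        unfolding step[of "Suc n"] Suc by (simp add: ennreal_mult prod_nonneg)
    qed
  qed
  have "{\<omega>. \<forall>k\<le>t. \<omega> k = s k} = prod_emb UNIV ?N {0..<Suc t} (?S (Suc t))"
  proof -
    have "(\<forall>k\<le>t. \<omega> k = s k) \<longleftrightarrow> restrict \<omega> {0..<Suc t} = restrict s {0..<Suc t}" for \<omega>
      by (metis (mono_tags, lifting) atLeastLessThan_iff less_Suc_eq_le restrict_apply' restrict_ext zero_le)
    then show ?thesis by (auto simp: prod_emb_iff simp del: restrict_apply)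
  qed
  then have "emeasure (markov_chain M i) {\<omega>. \<forall>k\<le>t. \<omega> k = s k} =
      emeasure (IT.CI {0..<Suc t}) (?S (Suc t))"
    unfolding markov_chain_def using IT.lim[OF _ S_sets[of "Suc t"]] by simp
  also have "\<dots> = emeasure (IT.C 0 (Suc t) (\<lambda>_. undefined))
      (prod_emb {0..<Suc t} ?N {0..<Suc t} (?S (Suc t)))"
    by (rule IT.emeasure_CI[OF subset_refl S_sets])
  also have "prod_emb {0..<Suc t} ?N {0..<Suc t} (?S (Suc t)) = ?S (Suc t)"
    using sets.sets_into_space[OF S_sets[of "Suc t"]] by (intro prod_emb_id) (simp add: space_PiM)
  finally show ?thesis unfolding C .
qed


section \<open>Noisy consensus\<close>

primrec consensus ::
  "real^'n^'n \<Rightarrow> real^'n \<Rightarrow> (nat \<Rightarrow> 'a \<Rightarrow> real^'n) \<Rightarrow> nat \<Rightarrow> 'a \<Rightarrow> real^'n" where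
  "consensus P x0 w 0 \<omega> = x0"
| "consensus P x0 w (Suc t) \<omega> = P *v consensus P x0 w t \<omega> + w t \<omega>"

definition weighted_average :: "real^'n \<Rightarrow> real^'n \<Rightarrow> real^'n" where
  "weighted_average \<pi> x = (\<Sum>i\<in>UNIV. \<pi> $ i * x $ i) *\<^sub>R 1"

definition consensus_error ::
  "real^'n^'n \<Rightarrow> real^'n \<Rightarrow> real^'n \<Rightarrow> (nat \<Rightarrow> 'a \<Rightarrow> real^'n) \<Rightarrow> nat \<Rightarrow> 'a \<Rightarrow> real^'n" where
  "consensus_error P \<pi> x0 w t \<omega> =
     consensus P x0 w t \<omega> - weighted_average \<pi> (consensus P x0 w t \<omega>)"

definition disagreement ::
  "'a measure \<Rightarrow> real^'n^'n \<Rightarrow> real^'n \<Rightarrow> real^'n \<Rightarrow> (nat \<Rightarrow> 'a \<Rightarrow> real^'n) \<Rightarrow> nat \<Rightarrow> real" where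
  "disagreement \<Omega> P \<pi> x0 w t =
     (\<Sum>i\<in>UNIV. \<pi> $ i * (\<integral>\<omega>. (consensus_error P \<pi> x0 w t \<omega> $ i)\<^sup>2 \<partial>\<Omega>))"

definition steady_state_disagreement ::
  "'a measure \<Rightarrow> real^'n^'n \<Rightarrow> real^'n \<Rightarrow> real^'n \<Rightarrow> (nat \<Rightarrow> 'a \<Rightarrow> real^'n) \<Rightarrow> ereal" where
  "steady_state_disagreement \<Omega> P \<pi> x0 w = limsup (\<lambda>t. ereal (disagreement \<Omega> P \<pi> x0 w t))"

text \<open>
  Integrability of all products \<open>w\<^sub>i(t) w\<^sub>j(t)\<close> says that the covariance is finite; on a
  probability space it implies that the means exist.
\<close>

definition iid_noise ::
  "'a measure \<Rightarrow> (nat \<Rightarrow> 'a \<Rightarrow> real^'n) \<Rightarrow> real^'n^'n \<Rightarrow> bool" where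
  "iid_noise \<Omega> w \<Sigma> \<longleftrightarrow>
     prob_space \<Omega> \<and>
     prob_space.indep_vars \<Omega> (\<lambda>_. borel) w UNIV \<and>
     (\<forall>t. distr \<Omega> borel (w t) = distr \<Omega> borel (w 0)) \<and>
     (\<forall>t i. (\<integral>\<omega>. w t \<omega> $ i \<partial>\<Omega>) = 0) \<and>
     (\<forall>t i j. integrable \<Omega> (\<lambda>\<omega>. w t \<omega> $ i * w t \<omega> $ j) \<and>
              (\<integral>\<omega>. w t \<omega> $ i * w t \<omega> $ j \<partial>\<Omega>) = \<Sigma> $ i $ j)"

end

(*
  With M = P^2 and H = H_M, first-step analysis and stationarity give (I - M) H = 1 1^T - D_pi^-1, so
  the partial sums of M^s - 1 pi^T telescope to (M^T H - H) D_pi. Their diagonal entries are bounded,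
  and by reversibility pi_i (M^s_ii - pi_i) is the squared pi-weighted norm of column i of P^s - 1 pi^T;
  a nonnegative series with bounded partial sums has terms tending to 0, so P^s -> 1 pi^T and the
  partial sums converge to 1 (pi^T H D_pi) - H D_pi. On the other side, the disagreement at time t is
  the pairing of D_pi (M^s - 1 pi^T), summed over s < t, with the noise covariance, plus a
  vanishing term coming from the initial state.
*)
theory Submission
  imports Defs
begin

section \<open>Matrix powers and stochastic matrices\<close>

lemma matrix_power_0: "matrix_power P 0 = mat 1"
  by (simp add: matrix_power_def)

lemma matrix_power_Suc: "matrix_power P (Suc k) = P ** matrix_power P k"
  by (simp add: matrix_power_def)

lemma matrix_power_add: "matrix_power P (k + l) = matrix_power P k ** matrix_power P l"
  by (induction k) (simp_all add: matrix_power_0 matrix_power_Suc matrix_mul_assoc)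

lemma matrix_power_1: "matrix_power P 1 = P"
  by (simp add: matrix_power_def)

lemma matrix_power_Suc_right: "matrix_power P (Suc k) = matrix_power P k ** P"
  using matrix_power_add[of P k 1] matrix_power_1[of P] by simp

lemma matrix_power_square: "matrix_power (P ** P) k = matrix_power P (2 * k)"
  by (induction k) (simp_all add: matrix_power_0 matrix_power_Suc matrix_mul_assoc)

lemma matrix_mult_nth: "(A ** B) $ i $ j = (\<Sum>k\<in>UNIV. A $ i $ k * B $ k $ j)"
  by (simp add: matrix_matrix_mult_def)

lemma stochasticD:
  assumes "stochastic P"
  shows "0 \<le> P $ i $ j" "(\<Sum>j\<in>UNIV. P $ i $ j) = 1"
  using assms by (auto simp: stochastic_def)

lemma stochastic_mult:
  fixes A B :: "real^'n^'n"
  assumes "stochastic A" "stochastic B"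
  shows "stochastic (A ** B)"
proof -
  have "(\<Sum>j\<in>UNIV. (A ** B) $ i $ j) = 1" for i
  proof -
    have "(\<Sum>j\<in>UNIV. (A ** B) $ i $ j) = (\<Sum>k\<in>UNIV. \<Sum>j\<in>UNIV. A $ i $ k * B $ k $ j)"
      unfolding matrix_mult_nth by (rule sum.swap)
    then show ?thesis
      using assms by (simp add: sum_distrib_left[symmetric] stochasticD)
  qed
  moreover have "0 \<le> (A ** B) $ i $ j" for i j
    using assms by (auto simp: matrix_mult_nth stochasticD intro!: sum_nonneg)
  ultimately show ?thesis by (simp add: stochastic_def)
qed

lemma stochastic_power:
  fixes P :: "real^'n^'n"
  assumes "stochastic P"
  shows "stochastic (matrix_power P k)"
proof (induction k)
  case 0
  show ?case by (auto simp: stochastic_def matrix_power_0 mat_def)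
next
  case (Suc k)
  then show ?case by (simp add: matrix_power_Suc stochastic_mult assms)
qed

lemma matrix_mult_pos:
  fixes A B :: "real^'n^'n"
  assumes "stochastic A" "stochastic B" "0 < A $ i $ k" "0 < B $ k $ j"
  shows "0 < (A ** B) $ i $ j"
  unfolding matrix_mult_nth
  using assms by (intro sum_pos2[of _ k]) (auto simp: stochasticD)

lemma matrix_mult_posE:
  fixes A B :: "real^'n^'n"
  assumes "stochastic A" "stochastic B" "0 < (A ** B) $ i $ j"
  obtains k where "0 < A $ i $ k" "0 < B $ k $ j"
proof -
  have "\<exists>k. A $ i $ k * B $ k $ j \<noteq> 0"
    using assms(3) unfolding matrix_mult_nth by (metis (mono_tags, lifting) less_irrefl sum.neutral)
  then obtain k where "A $ i $ k * B $ k $ j \<noteq> 0" ..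
  then have "A $ i $ k \<noteq> 0" "B $ k $ j \<noteq> 0" by auto
  then show thesis
    using that[of k] stochasticD(1)[OF assms(1), of i k] stochasticD(1)[OF assms(2), of k j] by linarith
qed

section \<open>Stationarity and reversibility of matrix powers\<close>

lemma stationary_power:
  fixes P :: "real^'n^'n"
  assumes "stationary_distribution P \<pi>"
  shows "stationary_distribution (matrix_power P k) \<pi>"
proof (induction k)
  case 0
  then show ?case using assms by (simp add: stationary_distribution_def matrix_power_0)
next
  case (Suc k)
  have "\<pi> v* (P ** matrix_power P k) = (\<pi> v* P) v* matrix_power P k"
    by (rule vector_matrix_mul_assoc[symmetric])
  then show ?case using Suc assms by (simp add: stationary_distribution_def matrix_power_Suc)
qed

lemma stationary_sum:
  assumes "stationary_distribution P \<pi>"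
  shows "(\<Sum>i\<in>UNIV. \<pi> $ i * P $ i $ j) = \<pi> $ j"
proof -
  have "(\<pi> v* P) $ j = \<pi> $ j" using assms by (simp add: stationary_distribution_def)
  then show ?thesis by (simp add: vector_matrix_mult_def mult.commute)
qed

text \<open>Detailed balance carries \<pi> through one factor at a time and reverses the order of
  the factors. Reversing \<open>P ** ?Q\<close> gives \<open>?Q ** P\<close>, and both are the next
  power of \<open>P\<close>.\<close>

lemma reversible_power:
  fixes P :: "real^'n^'n"
  assumes "reversible_wrt P \<pi>"
  shows "reversible_wrt (matrix_power P k) \<pi>"
proof (induction k)
  case 0
  show ?case by (simp add: reversible_wrt_def matrix_power_0 mat_def)
next
  case (Suc k)
  let ?Q = "matrix_power P k"
  have "\<pi> $ i * (P ** ?Q) $ i $ j = \<pi> $ j * (?Q ** P) $ j $ i" for i j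
  proof -
    have "\<pi> $ i * (P $ i $ l * ?Q $ l $ j) = \<pi> $ j * (?Q $ j $ l * P $ l $ i)" for l
    proof -
      have "\<pi> $ i * (P $ i $ l * ?Q $ l $ j) = (\<pi> $ i * P $ i $ l) * ?Q $ l $ j" by simp
      also have "\<dots> = P $ l $ i * (\<pi> $ l * ?Q $ l $ j)"
      proof -
        have "\<pi> $ i * P $ i $ l = \<pi> $ l * P $ l $ i"
          using assms by (simp only: reversible_wrt_def)
        then show ?thesis by simp
      qed
      also have "\<pi> $ l * ?Q $ l $ j = \<pi> $ j * ?Q $ j $ l"
        using Suc unfolding reversible_wrt_def by blast
      finally show ?thesis by simp
    qed
    then show ?thesis by (simp add: matrix_mult_nth sum_distrib_left)
  qed
  then show ?case
    unfolding reversible_wrt_def by (metis matrix_power_Suc matrix_power_Suc_right)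
qed

text \<open>\<open>stationary_distribution\<close> fixes the total mass but says nothing about
  signs. Total mass 1 forces one positive entry, and detailed balance for a suitable power carries
  positivity from it to every state.\<close>

lemma reversible_irreducible_pos:
  fixes P :: "real^'n^'n"
  assumes "stochastic P" "irreducible_matrix P" "stationary_distribution P \<pi>" "reversible_wrt P \<pi>"
  shows "0 < \<pi> $ j"
proof -
  have "\<exists>i. 0 < \<pi> $ i"
  proof (rule ccontr)
    assume "\<not> ?thesis"
    then have "(\<Sum>i\<in>UNIV. \<pi> $ i) \<le> 0" by (intro sum_nonpos) (simp add: not_less)
    then show False using assms(3) by (simp add: stationary_distribution_def)
  qed
  then obtain i where "0 < \<pi> $ i" ..
  moreover obtain k where "0 < matrix_power P k $ i $ j"
    using assms(2) unfolding irreducible_matrix_def by blast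
  ultimately
have "0 < \<pi> $ j * matrix_power P k $ j $ i"
    using reversible_power[OF assms(4), of k] by (metis mult_pos_pos reversible_wrt_def)
  then show ?thesis
    using stochasticD(1)[OF stochastic_power[OF assms(1)], of k j i]
    by (simp add: zero_less_mult_iff)
qed

text \<open>Aperiodicity provides an odd cycle, which corrects the parity of any connecting path.\<close>

lemma irreducible_square:
  fixes P :: "real^'n^'n"
  assumes "stochastic P" "irreducible_matrix P" "aperiodic_matrix P"
  shows "irreducible_matrix (P ** P)"
  unfolding irreducible_matrix_def matrix_power_square
proof (intro allI)
  fix i j
  obtain k where k: "0 < matrix_power P k $ i $ j"
    using assms(2) by (auto simp: irreducible_matrix_def)
  have "\<exists>m. odd m \<and> 0 < matrix_power P m $ i $ i"
  proof (rule ccontr)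
    assume "\<not> ?thesis"
    then have "2 dvd Gcd {k. 0 < k \<and> 0 < matrix_power P k $ i $ i}"
      by (intro Gcd_greatest) auto
    then show False using assms(3) by (simp add: aperiodic_matrix_def)
  qed
  then obtain m where m: "odd m" "0 < matrix_power P m $ i $ i" by auto
  have "0 < matrix_power P (m + k) $ i $ j"
    unfolding matrix_power_add
    using m(2) k by (intro matrix_mult_pos stochastic_power assms)
  moreover have "even k \<or> even (m + k)" using m(1) by simp
  ultimately show "\<exists>k. 0 < matrix_power P (2 * k) $ i $ j"
    using k by (metis evenE)
qed

section \<open>Hitting times as potentials\<close>

lemma space_markov_chain: "space (markov_chain M i) = UNIV"
  and sets_markov_chain: "sets (markov_chain M i) = sets (PiM UNIV (\<lambda>_. count_space UNIV))"
  if "stochastic M" for M :: "real^'n^'n"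
proof -
  interpret IT: Ionescu_Tulcea "chain_kernel M i" "\<lambda>_. count_space UNIV"
    by (rule Ionescu_Tulcea_chain_kernel[OF that])
  show "space (markov_chain M i) = UNIV"
    unfolding markov_chain_def IT.PF.space_lim by (simp add: space_PiM)
  show "sets (markov_chain M i) = sets (PiM UNIV (\<lambda>_. count_space UNIV))"
    unfolding markov_chain_def IT.PF.sets_lim ..
qed

section \<open>First visits and sums over paths\<close>

lemma less_first_visit_iff: "enat t < first_visit j \<omega> \<longleftrightarrow> (\<forall>k\<le>t. \<omega> k \<noteq> j)"
proof
  assume less: "enat t < first_visit j \<omega>"
  have "t < k" if "\<omega> k = j" for k
  proof -
    have "first_visit j \<omega> \<le> enat k"
      unfolding first_visit_def using that by (intro INF_lower) simp
    with less have "enat t < enat k" by (rule less_le_trans)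
    then show ?thesis by simp
  qed
  then show "\<forall>k\<le>t. \<omega> k \<noteq> j" by (metis not_less)
next
  assume avoid: "\<forall>k\<le>t. \<omega> k \<noteq> j"
  have "enat (Suc t) \<le> first_visit j \<omega>"
    unfolding first_visit_def
  proof (rule INF_greatest)
    fix k assume "k \<in> {t. \<omega> t = j}"
    with avoid have "Suc t \<le> k" by (metis mem_Collect_eq not_less_eq_eq)
    then show "enat (Suc t) \<le> enat k" by simp
  qed
  then show "enat t < first_visit j \<omega>"
    by (meson enat_ord_simps(2) lessI less_le_trans)
qed

text \<open>In \<open>first_visit\<close> the index set of the infimum depends on the trajectory.
  Giving the value \<infinity> to times without a visit turns it into an infimum over all times,
  which is countable.\<close>

lemma measurable_first_visit:
  fixes j :: "'n::finite"
  shows "first_visit j \<in> PiM UNIV (\<lambda>_. count_space UNIV) \<rightarrow>\<^sub>M count_space UNIV"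
proof -
  have eq: "first_visit j = (\<lambda>\<omega>. INF t. if \<omega> t = j then enat t else \<infinity>)"
  proof
    fix \<omega>
    have "first_visit j \<omega> \<le> (INF t. if \<omega> t = j then enat t else \<infinity>)"
      unfolding first_visit_def by (intro INF_greatest) (auto intro: INF_lower)
    moreover have "(INF t. if \<omega> t = j then enat t else \<infinity>) \<le> first_visit j \<omega>"
      unfolding first_visit_def
    proof (rule INF_greatest)
      fix k assume "k \<in> {t. \<omega> t = j}"
      then show "(INF t. if \<omega> t = j then enat t else \<infinity>) \<le> enat k"
        by (intro INF_lower2[of k]) auto
    qed
    ultimately show "first_visit j \<omega> = (INF t. if \<omega> t = j then enat t else \<infinity>)" by simp
  qed
  have "(\<lambda>\<omega>. if \<omega> t = j then enat t else \<infinity>) \<in>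
      PiM UNIV (\<lambda>_. count_space UNIV) \<rightarrow>\<^sub>M count_space UNIV" for t :: nat
    by measurable
  then show ?thesis unfolding eq by (intro measurable_INF) auto
qed

text \<open>Powers of the taboo matrix describe the chain as long as it avoids \<open>j\<close> at times \<open>1, \<dots>, t\<close>;
  the starting point is not constrained.\<close>

definition taboo_matrix :: "real^'n^'n \<Rightarrow> 'n \<Rightarrow> real^'n^'n" where
  "taboo_matrix M j = (\<chi> i k. if k = j then 0 else M $ i $ k)"

text \<open>The terminal weight \<open>g\<close> is there for the induction: the last step of a path
  is absorbed into it, replacing \<open>g\<close> by \<open>taboo_matrix M j *v g\<close>. The case
  \<open>i = j\<close> is separate because the paths avoid \<open>j\<close> at time 0 as well, while
  the taboo matrix only forbids entering \<open>j\<close>.\<close>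

lemma sum_paths_avoiding:
  fixes M :: "real^'n^'n" and g :: "real^'n"
  shows "(\<Sum>s\<in>PiE {..t} (\<lambda>_. - {j}).
      (if s 0 = i then (\<Prod>k<t. M $ s k $ s (Suc k)) else 0) * g $ s t) =
    (if i = j then 0 else (matrix_power (taboo_matrix M j) t *v g) $ i)"
proof (induction t arbitrary: g)
  case 0
  have "PiE {..0::nat} (\<lambda>_. - {j}) = (\<lambda>x. \<lambda>k\<in>{0}. x) ` (- {j})"
  proof -
    have "{..0::nat} = {0}" by auto
    then show ?thesis by (simp only: PiE_over_singleton_iff) blast
  qed
  moreover have "inj_on (\<lambda>x. \<lambda>k\<in>{0::nat}. x) (- {j})"
    by (rule inj_onI) (metis restrict_apply' singletonI)
  ultimately have "(\<Sum>s\<in>PiE {..0::nat} (\<lambda>_. - {j}). (if s 0 = i then 1 else 0) * g $ s 0) =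
      (\<Sum>x\<in>- {j}. (if x = i then 1 else 0) * g $ x)"
    by (simp add: sum.reindex)
  also have "\<dots> = (if i = j then 0 else g $ i)"
    by (simp add: if_distrib[of "\<lambda>x. x * _"] cong: if_cong)
  finally show ?case by (simp add: matrix_power_0 cong: if_cong)
next
  case (Suc t)
  let ?B = "taboo_matrix M j" and ?Q = "PiE {..t} (\<lambda>_. - {j})"
  let ?w = "\<lambda>s. if s 0 = i then (\<Prod>k<t. M $ s k $ s (Suc k)) else 0"
  let ?w' = "\<lambda>s. if s 0 = i then (\<Prod>k<Suc t. M $ s k $ s (Suc k)) else 0"
  \<comment> \<open>A path up to \<open>Suc t\<close> is split into its last state \<open>y\<close>
    and its restriction \<open>s\<close> to the earlier times.\<close>
  have "(\<Sum>s\<in>PiE {..Suc t} (\<lambda>_. - {j}). ?w' s * g $ s (Suc t)) =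
      (\<Sum>(y, s)\<in>(- {j}) \<times> ?Q. ?w' (s(Suc t := y)) * g $ y)"
    unfolding atMost_Suc PiE_insert_eq
    by (subst sum.reindex[OF inj_combinator]) (auto intro!: sum.cong)
  also have "\<dots> = (\<Sum>(y, s)\<in>(- {j}) \<times> ?Q. ?w s * (M $ s t $ y * g $ y))"
  proof -
    have "?w' (s(Suc t := y)) * g $ y = ?w s * (M $ s t $ y * g $ y)" for y s
    proof -
      have "(\<Prod>k<t. M $ (s(Suc t := y)) k $ (s(Suc t := y)) (Suc k)) = (\<Prod>k<t. M $ s k $ s (Suc k))"
      by (intro prod.cong) auto
      then show ?thesis by simp
    qed
    then show ?thesis by (simp only: split_def)
  qed
  also have "\<dots> = (\<Sum>s\<in>?Q. \<Sum>y\<in>- {j}. ?w s * (M $ s t $ y * g $ y))"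
    unfolding sum.cartesian_product[symmetric] by (rule sum.swap)
  also have "\<dots> = (\<Sum>s\<in>?Q. ?w s * (?B *v g) $ s t)"
  proof (intro sum.cong refl)
    fix s
    have "(?B *v g) $ s t = (\<Sum>y\<in>- {j}. M $ s t $ y * g $ y)"
      unfolding matrix_vector_mult_def vec_lambda_beta
      by (rule sum.mono_neutral_cong_right) (auto simp: taboo_matrix_def)
    then show "(\<Sum>y\<in>- {j}. ?w s * (M $ s t $ y * g $ y)) = ?w s * (?B *v g) $ s t"
      by (simp only: sum_distrib_left)
  qed
  also have "\<dots> = (if i = j then 0 else (matrix_power ?B t *v (?B *v g)) $ i)"
    by (rule Suc)
  finally show ?case
    by (simp only: matrix_power_Suc_right matrix_vector_mul_assoc)
qed

lemma taboo_power_nonneg: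
  assumes "stochastic M"
  shows "0 \<le> (matrix_power (taboo_matrix M j) t *v 1) $ i"
proof (induction t arbitrary: i)
  case 0
  show ?case by (simp add: matrix_power_0)
next
  case (Suc t)
  have "0 \<le> (taboo_matrix M j *v (matrix_power (taboo_matrix M j) t *v 1)) $ i"
    unfolding matrix_vector_mult_def[of "taboo_matrix M j"] vec_lambda_beta
    using Suc assms by (auto simp: taboo_matrix_def stochasticD intro!: sum_nonneg)
  then show ?case by (simp add: matrix_power_Suc matrix_vector_mul_assoc)
qed

text \<open>Tail-sum formula: the mean of a variable with values in the extended naturals is the sum
  of the probabilities that it exceeds \<open>t\<close>. Each such event is a finite disjoint union
  of cylinders, one for each path up to time \<open>t\<close> that avoids \<open>j\<close>.\<close>

lemma hitting_time_eq_suminf: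
  fixes M :: "real^'n^'n"
  assumes "stochastic M"
  shows "hitting_time M i j =
    (\<Sum>t. ennreal (if i = j then 0 else (matrix_power (taboo_matrix M j) t *v 1) $ i))"
proof -
  let ?M = "markov_chain M i"
  note sets = sets_markov_chain[OF assms, of i]
  have cyl: "{\<omega>. \<forall>k\<le>t. \<omega> k = s k} \<in> sets ?M" for t :: nat and s :: "nat \<Rightarrow> 'n"
  proof -
    have "{\<omega> \<in> space (PiM UNIV (\<lambda>_. count_space UNIV)). \<forall>k\<in>{..t}. \<omega> k = s k}
        \<in> sets (PiM UNIV (\<lambda>_::nat. count_space (UNIV :: 'n set)))"
      by measurable
    then show ?thesis unfolding sets by (simp add: space_PiM Ball_def)
  qed
  have "emeasure ?M {\<omega>. enat t < first_visit j \<omega>} =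
      ennreal (if i = j then 0 else (matrix_power (taboo_matrix M j) t *v 1) $ i)" for t
  proof -
    let ?Q = "PiE {..t} (\<lambda>_. - {j})"
    let ?w = "\<lambda>s. if s 0 = i then (\<Prod>k<t. M $ s k $ s (Suc k)) else 0"
    have "{\<omega>. enat t < first_visit j \<omega>} = (\<Union>s\<in>?Q. {\<omega>. \<forall>k\<le>t. \<omega> k = s k})"
    proof (intro set_eqI iffI)
      fix \<omega> assume "\<omega> \<in> {\<omega>. enat t < first_visit j \<omega>}"
      then have "restrict \<omega> {..t} \<in> ?Q"
        by (simp only: restrict_PiE Pi_iff) (simp add: less_first_visit_iff)
      then show "\<omega> \<in> (\<Union>s\<in>?Q. {\<omega>. \<forall>k\<le>t. \<omega> k = s k})" by (rule UN_I) simp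
    next
      fix \<omega> assume "\<omega> \<in> (\<Union>s\<in>?Q. {\<omega>. \<forall>k\<le>t. \<omega> k = s k})"
      then show "\<omega> \<in> {\<omega>. enat t < first_visit j \<omega>}"
        by (force simp: less_first_visit_iff PiE_iff)
    qed
    moreover have "disjoint_family_on (\<lambda>s. {\<omega>. \<forall>k\<le>t. \<omega> k = s k}) ?Q"
    proof (unfold disjoint_family_on_def, intro ballI impI)
      fix s s' assume "s \<in> ?Q" "s' \<in> ?Q" "s \<noteq> s'"
      then obtain k where "k \<le> t" "s k \<noteq> s' k"
        by (metis PiE_ext atMost_iff)
      then show "{\<omega>. \<forall>k\<le>t. \<omega> k = s k} \<inter> {\<omega>. \<forall>k\<le>t. \<omega> k = s' k} = {}" by force
    qed
    ultimately have "emeasure ?M {\<omega>. enat t < first_visit j \<omega>} =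
        (\<Sum>s\<in>?Q. emeasure ?M {\<omega>. \<forall>k\<le>t. \<omega> k = s k})"
      using cyl by (subst sum_emeasure) (auto intro!: finite_PiE)
    also have "\<dots> = (\<Sum>s\<in>?Q. ennreal (?w s))"
      unfolding emeasure_markov_chain_cylinder[OF assms] by (intro sum.cong) auto
    also have "\<dots> = ennreal (\<Sum>s\<in>?Q. ?w s)"
      using assms by (intro sum_ennreal) (auto intro!: prod_nonneg simp: stochasticD)
    also have "(\<Sum>s\<in>?Q. ?w s) = (if i = j then 0 else (matrix_power (taboo_matrix M j) t *v 1) $ i)"
      using sum_paths_avoiding[where g = 1 and M = M and i = i and j = j and t = t] by simp
    finally show ?thesis .
  qed
  moreover have "first_visit j \<in> measurable ?M (count_space UNIV)"
    using measurable_first_visit by (simp add: measurable_cong_sets[OF sets refl])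
  ultimately show ?thesis
    unfolding hitting_time_def
    by (subst nn_integral_enat_function) (auto simp: space_markov_chain[OF assms])
qed

text \<open>Off the diagonal this is first-step analysis. On the diagonal the right-hand side
  vanishes because the mean return time to \<open>j\<close> is \<open>1 / \<pi> $ j\<close>.
  Finiteness has to be proved on the way, since \<open>enn2real\<close> would hide an infinite
  hitting time.\<close>

lemma hitting_matrix_first_step:
  fixes M :: "real^'n^'n"
  assumes M: "stochastic M" and irr: "irreducible_matrix M"
    and stat: "stationary_distribution M \<pi>" and pos: "\<And>j. 0 < \<pi> $ j"
  shows "hitting_matrix M $ i $ j =
    1 + (\<Sum>k\<in>UNIV. M $ i $ k * hitting_matrix M $ k $ j) - (if i = j then 1 / \<pi> $ j else 0)"
proof -
  \<comment> \<open>\<open>a t i\<close> is the probability of avoiding \<open>j\<close> at times 1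
    to \<open>t\<close> from the start \<open>i\<close>. The start itself does not count, so for
    \<open>i = j\<close> the sum over \<open>t\<close> is a mean return time rather than 0.\<close>
  define a where "a t i = (matrix_power (taboo_matrix M j) t *v 1) $ i" for t i
  have a_nonneg: "0 \<le> a t i" for t i
    unfolding a_def by (rule taboo_power_nonneg[OF M])
  have a_0: "a 0 i = 1" for i by (simp add: a_def matrix_power_0)
  have a_Suc: "a (Suc t) i = (\<Sum>k\<in>- {j}. M $ i $ k * a t k)" for t i
  proof -
    have "a (Suc t) i = (taboo_matrix M j *v (matrix_power (taboo_matrix M j) t *v 1)) $ i"
      by (simp add: a_def matrix_power_Suc matrix_vector_mul_assoc)
    also have "\<dots> = (\<Sum>k\<in>UNIV. taboo_matrix M j $ i $ k * a t k)"
      unfolding a_def by (simp add: matrix_vector_mult_def[of "taboo_matrix M j"])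
    also have "\<dots> = (\<Sum>k\<in>- {j}. M $ i $ k * a t k)"
      by (rule sum.mono_neutral_cong_right) (auto simp: taboo_matrix_def)
    finally show ?thesis .
  qed
  \<comment> \<open>Truncated sums stay finite, so terms may be cancelled before summability is
    known.\<close>
  define S where "S T i = (\<Sum>t<T. a t i)" for T i
  have S_mono: "S T i \<le> S (Suc T) i" for T i
    using a_nonneg by (simp add: S_def)
  have S_nonneg: "0 \<le> S T i" for T i
    using a_nonneg by (simp add: S_def sum_nonneg)
  have S_Suc: "S (Suc T) i = 1 + (\<Sum>k\<in>- {j}. M $ i $ k * S T k)" for T i
    unfolding S_def sum.lessThan_Suc_shift a_0 a_Suc
    by (simp add: sum_distrib_left sum.swap[of _ _ "{..<T}"])
  txt \<open>Averaging against \<open>\<pi>\<close> bounds the expected number of steps away from \<open>j\<close> in one excursion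
    from \<open>j\<close> (Kac's formula); the bound then spreads along the paths leaving \<open>j\<close>.\<close>
  have average: "(\<Sum>i\<in>UNIV. \<pi> $ i * (1 + (\<Sum>k\<in>- {j}. M $ i $ k * f k))) =
      1 + (\<Sum>k\<in>- {j}. \<pi> $ k * f k)" for f
  proof -
    have "(\<Sum>i\<in>UNIV. \<pi> $ i * (\<Sum>k\<in>- {j}. M $ i $ k * f k)) =
        (\<Sum>k\<in>- {j}. (\<Sum>i\<in>UNIV. \<pi> $ i * M $ i $ k) * f k)"
      by (simp add: sum_distrib_left sum_distrib_right sum.swap[of _ _ UNIV] mult.assoc)
    also have "\<dots> = (\<Sum>k\<in>- {j}. \<pi> $ k * f k)"
      by (simp add: stationary_sum[OF stat])
    finally show ?thesis
      using stat by (simp add: stationary_distribution_def distrib_left sum.distrib)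
  qed
  have split: "(\<Sum>i\<in>UNIV. g i) = g j + (\<Sum>k\<in>- {j}. g k)" for g :: "'n \<Rightarrow> real"
    by (simp add: sum.remove[of UNIV j] Compl_eq_Diff_UNIV)
  have S_j: "S T j \<le> 1 / \<pi> $ j" for T
  proof -
    have "\<pi> $ j * S (Suc T) j + (\<Sum>k\<in>- {j}. \<pi> $ k * S (Suc T) k) =
        1 + (\<Sum>k\<in>- {j}. \<pi> $ k * S T k)"
      using average[of "S T"] by (simp add: S_Suc[symmetric] split)
    \<comment> \<open>After raising \<open>T\<close> to \<open>Suc T\<close> on the right, the terms
      off \<open>j\<close> are the same on both sides and cancel.\<close>
    also have "\<dots> \<le> 1 + (\<Sum>k\<in>- {j}. \<pi> $ k * S (Suc T) k)"
      using pos S_mono by (intro add_left_mono sum_mono mult_left_mono) (auto simp: less_imp_le)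
    finally have "S (Suc T) j \<le> 1 / \<pi> $ j"
      using pos[of j] by (simp add: field_simps)
    then show ?thesis using S_mono[of T j] by linarith
  qed
  have S_bounded: "\<exists>C. \<forall>T. S T k \<le> C" if "0 < matrix_power M n $ j $ k" for n k
    using that
  proof (induction n arbitrary: k)
    case 0
    then have "k = j" by (simp add: matrix_power_0 mat_def split: if_splits)
    then show ?case using S_j by blast
  next
    case (Suc n)
    then obtain l where l: "0 < matrix_power M n $ j $ l" "0 < M $ l $ k"
      unfolding matrix_power_Suc_right
      by (metis matrix_mult_posE stochastic_power M)
    obtain C where C: "\<And>T. S T l \<le> C" using Suc.IH[OF l(1)] by blast
    show ?case
    proof (cases "k = j")
      case True
      then show ?thesis using S_j by blast
    next
      case False
      have "S T k \<le> C / M $ l $ k" for T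
      proof -
        \<comment> \<open>One term of the recursion at \<open>l\<close> bounds \<open>S T k\<close>.
          The recursion has no term for \<open>j\<close>, hence the case split.\<close>
        have "M $ l $ k * S T k \<le> (\<Sum>k\<in>- {j}. M $ l $ k * S T k)"
          using False M S_nonneg by (intro member_le_sum) (auto simp: stochasticD)
        also have "\<dots> \<le> S (Suc T) l" by (simp add: S_Suc)
        also have "\<dots> \<le> C" by (rule C)
        finally show ?thesis using l(2) by (simp add: field_simps)
      qed
      then show ?thesis by blast
    qed
  qed
  have summable: "summable (\<lambda>t. a t k)" for k
  proof -
    obtain n where "0 < matrix_power M n $ j $ k"
      using irr unfolding irreducible_matrix_def by blast
    then obtain C where "\<And>T. S T k \<le> C" using S_bounded by blast
    then show ?thesis
      using a_nonneg by (intro summableI_nonneg_bounded[of _ C]) (auto simp: S_def)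
  qed
  define A where "A i = (\<Sum>t. a t i)" for i
  have A: "A i = 1 + (\<Sum>k\<in>- {j}. M $ i $ k * A k)" for i
  proof -
    have "A i = a 0 i + (\<Sum>t. a (Suc t) i)"
      unfolding A_def using suminf_split_head[OF summable[of i]] by simp
    also have "(\<Sum>t. a (Suc t) i) = (\<Sum>k\<in>- {j}. M $ i $ k * A k)"
      unfolding a_Suc A_def
      by (subst suminf_sum) (auto intro!: summable_mult summable simp: suminf_mult[OF summable])
    finally show ?thesis by (simp add: a_0)
  qed
  \<comment> \<open>The diagonal is reset to 0: \<open>A j\<close> is a return time, but for
    \<open>hitting_time\<close> the visit at time 0 counts.\<close>
  have "hitting_time M i j = ennreal (if i = j then 0 else A i)" for i
  proof (cases "i = j")
    case False
    then show ?thesis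
      unfolding hitting_time_eq_suminf[OF M] A_def
      using suminf_ennreal2[OF a_nonneg summable] by (simp add: a_def)
  qed (simp add: hitting_time_eq_suminf[OF M])
  moreover have "0 \<le> A i" for i
    unfolding A_def by (intro suminf_nonneg summable a_nonneg)
  ultimately have H: "hitting_matrix M $ i $ j = (if i = j then 0 else A i)" for i
    by (simp add: hitting_matrix_def)
  \<comment> \<open>Averaging the recursion for the full sums cancels every term off
    \<open>j\<close> and turns the earlier bound into the equality of Kac's formula.\<close>
  have "\<pi> $ j * A j = 1"
    using average[of A] by (simp add: A[symmetric] split)
  then have "A j = 1 / \<pi> $ j" using pos[of j] by (simp add: field_simps)
  moreover have "(\<Sum>k\<in>UNIV. M $ i $ k * hitting_matrix M $ k $ j) = (\<Sum>k\<in>- {j}. M $ i $ k * A k)"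
    unfolding split by (simp add: H)
  ultimately show ?thesis using A[of i] H[of i] by auto
qed

text \<open>Multiplying the first-step identity by \<open>matrix_power M T\<close> from the left,
  where rows sum to 1, exhibits the deviation at time \<open>T\<close> as a difference of
  consecutive terms, so the sum telescopes.\<close>

lemma sum_power_deviation:
  fixes M :: "real^'n^'n"
  assumes M: "stochastic M" and irr: "irreducible_matrix M"
    and stat: "stationary_distribution M \<pi>" and pos: "\<And>j. 0 < \<pi> $ j"
  shows "(\<Sum>s<T. matrix_power M s $ i $ j - \<pi> $ j) =
    \<pi> $ j * ((matrix_power M T ** hitting_matrix M) $ i $ j - hitting_matrix M $ i $ j)"
proof (induction T)
  case 0
  show ?case by (simp add: matrix_power_0)
next
  case (Suc T)
  let ?H = "hitting_matrix M" and ?Q = "matrix_power M T"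
  have "(?Q ** ?H) $ i $ j =
      (\<Sum>k\<in>UNIV. ?Q $ i $ k * (1 + (M ** ?H) $ k $ j - (if k = j then 1 / \<pi> $ j else 0)))"
    unfolding matrix_mult_nth[of ?Q]
  proof (intro sum.cong refl)
    fix k
    show "?Q $ i $ k * ?H $ k $ j =
        ?Q $ i $ k * (1 + (M ** ?H) $ k $ j - (if k = j then 1 / \<pi> $ j else 0))"
      using hitting_matrix_first_step[OF assms, of k j] by (simp add: matrix_mult_nth)
  qed
  also have "\<dots> = 1 + (?Q ** (M ** ?H)) $ i $ j - ?Q $ i $ j / \<pi> $ j"
    unfolding matrix_mult_nth[of ?Q]
  proof -
    have "?Q $ i $ k * (1 + (M ** ?H) $ k $ j - (if k = j then 1 / \<pi> $ j else 0)) =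
        ?Q $ i $ k + ?Q $ i $ k * (M ** ?H) $ k $ j - (if k = j then ?Q $ i $ k / \<pi> $ j else 0)" for k
      by (simp add: algebra_simps)
    then show "(\<Sum>k\<in>UNIV. ?Q $ i $ k * (1 + (M ** ?H) $ k $ j - (if k = j then 1 / \<pi> $ j else 0))) =
        1 + (\<Sum>k\<in>UNIV. ?Q $ i $ k * (M ** ?H) $ k $ j) - ?Q $ i $ j / \<pi> $ j"
      using stochasticD(2)[OF stochastic_power[OF M], of T i]
      by (simp add: sum.distrib sum_subtractf)
  qed
  finally have "?Q $ i $ j - \<pi> $ j =
      \<pi> $ j * ((matrix_power M (Suc T) ** ?H) $ i $ j - (?Q ** ?H) $ i $ j)"
    using pos[of j] unfolding matrix_power_Suc_right matrix_mul_assoc by (simp add: field_simps)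
  with Suc show ?case by (simp add: right_diff_distrib)
qed

section \<open>Convergence to the stationary distribution\<close>

text \<open>Expand the square. Detailed balance turns the quadratic terms into a diagonal entry of
  \<open>?Q ** ?Q\<close>, and stationarity evaluates the cross terms. In particular the right-hand
  side is nonnegative when the weights are.\<close>

lemma reversible_power_norm:
  fixes P :: "real^'n^'n"
  assumes "stationary_distribution P \<pi>" "reversible_wrt P \<pi>"
  shows "(\<Sum>k\<in>UNIV. \<pi> $ k * (matrix_power P s $ k $ i - \<pi> $ i)\<^sup>2) =
    \<pi> $ i * (matrix_power P (2 * s) $ i $ i - \<pi> $ i)"
proof -
  let ?Q = "matrix_power P s"
  have "\<pi> $ k * ?Q $ k $ i * ?Q $ k $ i = \<pi> $ i * (?Q $ i $ k * ?Q $ k $ i)" for k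
    using reversible_power[OF assms(2), of s] by (simp add: reversible_wrt_def)
  then have "(\<Sum>k\<in>UNIV. \<pi> $ k * (?Q $ k $ i - \<pi> $ i)\<^sup>2) =
      (\<Sum>k\<in>UNIV. \<pi> $ i * (?Q $ i $ k * ?Q $ k $ i) - 2 * \<pi> $ i * (\<pi> $ k * ?Q $ k $ i)
        + (\<pi> $ i)\<^sup>2 * \<pi> $ k)"
    by (intro sum.cong refl) (simp add: power2_diff power2_eq_square algebra_simps)
  also have "\<dots> = \<pi> $ i * (?Q ** ?Q) $ i $ i - 2 * \<pi> $ i * \<pi> $ i + (\<pi> $ i)\<^sup>2"
    using assms(1) stationary_sum[OF stationary_power[OF assms(1)], of s i]
    by (simp add: sum.distrib sum_subtractf sum_distrib_left[symmetric] matrix_mult_nth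
        stationary_distribution_def)
  also have "?Q ** ?Q = matrix_power P (2 * s)"
    by (simp add: matrix_power_add[symmetric] mult_2)
  finally show ?thesis by (simp add: power2_eq_square algebra_simps)
qed

text \<open>Aperiodicity enters through irreducibility of \<open>P ** P\<close>, which makes its
  hitting times finite and hence the even-time return deviations summable.\<close>

lemma reversible_power_tendsto:
  fixes P :: "real^'n^'n"
  assumes P: "stochastic P" "irreducible_matrix P" "aperiodic_matrix P"
    and stat: "stationary_distribution P \<pi>" and rev: "reversible_wrt P \<pi>"
  shows "(\<lambda>s. matrix_power P s $ k $ i) \<longlonglongrightarrow> \<pi> $ i"
proof -
  let ?M = "P ** P" and ?H = "hitting_matrix (P ** P)"
  note M = stochastic_mult[OF P(1) P(1)]
  have pos: "0 < \<pi> $ j" for j by (rule reversible_irreducible_pos[OF P(1,2) stat rev])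
  have statM: "stationary_distribution ?M \<pi>"
    using stationary_power[OF stat, of 2] by (simp add: matrix_power_def numeral_2_eq_2)
  define v where "v s = matrix_power P (2 * s) $ i $ i - \<pi> $ i" for s
  note v = reversible_power_norm[OF stat rev, where i = i, folded v_def]
  have v_nonneg: "0 \<le> v s" for s
  proof -
    have "0 \<le> \<pi> $ i * v s" unfolding v[symmetric] using pos by (intro sum_nonneg) (simp add: less_imp_le)
    then show ?thesis using pos[of i] by (simp add: zero_le_mult_iff)
  qed
  have H_nonneg: "0 \<le> ?H $ k $ i" for k by (simp add: hitting_matrix_def)
  have le_1: "matrix_power ?M T $ i $ k \<le> 1" for T k
    using member_le_sum[of k UNIV "\<lambda>k. matrix_power ?M T $ i $ k"]
    by (simp add: stochasticD[OF stochastic_power[OF M]])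
  \<comment> \<open>The subtracted term of the telescoped sum is dropped, and entries of powers of
    \<open>?M\<close> are at most 1, which removes \<open>T\<close> from the bound.\<close>
  have "(\<Sum>s<T. v s) \<le> \<pi> $ i * (\<Sum>k\<in>UNIV. ?H $ k $ i)" for T
  proof -
    have "(\<Sum>s<T. v s) = \<pi> $ i * ((matrix_power ?M T ** ?H) $ i $ i - ?H $ i $ i)"
      using sum_power_deviation[OF M irreducible_square[OF P] statM pos, where T = T and i = i and j = i]
      by (simp add: v_def matrix_power_square)
    also have "\<dots> \<le> \<pi> $ i * (matrix_power ?M T ** ?H) $ i $ i"
      using pos[of i] H_nonneg by (intro mult_left_mono) auto
    also have "\<dots> \<le> \<pi> $ i * (\<Sum>k\<in>UNIV. ?H $ k $ i)"
      unfolding matrix_mult_nth using pos[of i] H_nonneg le_1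
      by (intro mult_left_mono sum_mono mult_left_le_one_le)
        (auto simp: stochasticD[OF stochastic_power[OF M]])
    finally show ?thesis .
  qed
  then have "v \<longlonglongrightarrow> 0"
    using v_nonneg by (intro summable_LIMSEQ_zero summableI_nonneg_bounded)
  then have lim: "(\<lambda>s. \<pi> $ i * v s / \<pi> $ k) \<longlonglongrightarrow> 0" by (intro tendsto_divide_zero tendsto_mult_right_zero)
  \<comment> \<open>The weighted norm dominates each of its terms. Return deviations at even times
    \<open>2 * s\<close> thus control all of column \<open>i\<close> at every time \<open>s\<close>,
    odd ones included.\<close>
  have "(matrix_power P s $ k $ i - \<pi> $ i)\<^sup>2 \<le> \<pi> $ i * v s / \<pi> $ k" for s
  proof -
    have "\<pi> $ k * (matrix_power P s $ k $ i - \<pi> $ i)\<^sup>2 \<le> \<pi> $ i * v s"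
      unfolding v[symmetric] using pos by (intro member_le_sum) (auto simp: less_imp_le)
    then show ?thesis using pos[of k] by (simp add: field_simps)
  qed
  then have "(\<lambda>s. (matrix_power P s $ k $ i - \<pi> $ i)\<^sup>2) \<longlonglongrightarrow> 0"
    by (intro tendsto_sandwich[OF _ _ tendsto_const lim]) auto
  then have "(\<lambda>s. matrix_power P s $ k $ i - \<pi> $ i) \<longlonglongrightarrow> 0"
    by simp
  then show ?thesis by (simp add: LIM_zero_iff)
qed

section \<open>Second moments of the consensus iteration\<close>

text \<open>Discrete Lyapunov recursion for the uncentred moments of the state; the initial state is
  deterministic, so it contributes a rank-one matrix.\<close>

primrec second_moment :: "real^'n^'n \<Rightarrow> real^'n \<Rightarrow> real^'n^'n \<Rightarrow> nat \<Rightarrow> real^'n^'n" where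
  "second_moment P x0 \<Sigma> 0 = (\<chi> i j. x0 $ i * x0 $ j)"
| "second_moment P x0 \<Sigma> (Suc t) = P ** second_moment P x0 \<Sigma> t ** transpose P + \<Sigma>"

lemma congruence_nth:
  fixes P C :: "real^'n^'n"
  shows "(P ** C ** transpose P) $ i $ j =
    (\<Sum>k\<in>UNIV. \<Sum>l\<in>UNIV. P $ i $ k * P $ j $ l * C $ k $ l)"
proof -
  have "(P ** C ** transpose P) $ i $ j =
      (\<Sum>l\<in>UNIV. \<Sum>k\<in>UNIV. P $ i $ k * P $ j $ l * C $ k $ l)"
    unfolding matrix_mult_nth transpose_def sum_distrib_right
    by (intro sum.cong refl) (simp add: mult_ac)
  also note sum.swap
  finally show ?thesis .
qed

section \<open>Moments of the noise and of the state\<close>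

lemma borel_measurable_vec_nth: "(\<lambda>x :: real^'n. x $ i) \<in> borel_measurable borel"
  by (intro borel_measurable_continuous_onI continuous_intros)

lemma iid_noiseD:
  assumes "iid_noise \<Omega> w \<Sigma>"
  shows "prob_space \<Omega>" "prob_space.indep_vars \<Omega> (\<lambda>_. borel) w UNIV"
    "(\<integral>\<omega>. w t \<omega> $ i \<partial>\<Omega>) = 0"
    "integrable \<Omega> (\<lambda>\<omega>. w t \<omega> $ i * w t \<omega> $ j)"
    "(\<integral>\<omega>. w t \<omega> $ i * w t \<omega> $ j \<partial>\<Omega>) = \<Sigma> $ i $ j"
proof -
  from assms have moments: "(\<forall>t i. (\<integral>\<omega>. w t \<omega> $ i \<partial>\<Omega>) = 0) \<and>
     (\<forall>t i j. integrable \<Omega> (\<lambda>\<omega>. w t \<omega> $ i * w t \<omega> $ j) \<and>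
              (\<integral>\<omega>. w t \<omega> $ i * w t \<omega> $ j \<partial>\<Omega>) = \<Sigma> $ i $ j)"
    unfolding iid_noise_def by (elim conjE) (rule conjI)
  show "prob_space \<Omega>"
    using assms unfolding iid_noise_def by (rule conjunct1)
  show "prob_space.indep_vars \<Omega> (\<lambda>_. borel) w UNIV"
    using assms unfolding iid_noise_def by (elim conjE)
  show "(\<integral>\<omega>. w t \<omega> $ i \<partial>\<Omega>) = 0"
    "integrable \<Omega> (\<lambda>\<omega>. w t \<omega> $ i * w t \<omega> $ j)"
    "(\<integral>\<omega>. w t \<omega> $ i * w t \<omega> $ j \<partial>\<Omega>) = \<Sigma> $ i $ j"
    using moments by simp_all
qed

lemma noise_integrable:
  assumes noise: "iid_noise \<Omega> w \<Sigma>"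
  shows "integrable \<Omega> (\<lambda>\<omega>. w t \<omega> $ i)"
proof -
  interpret prob_space \<Omega> by (rule iid_noiseD(1)[OF noise])
  have "w t \<in> borel_measurable \<Omega>"
    using iid_noiseD(2)[OF noise, unfolded indep_vars_def, THEN conjunct1] by simp
  then have "(\<lambda>\<omega>. w t \<omega> $ i) \<in> borel_measurable \<Omega>"
    by (rule measurable_compose[OF _ borel_measurable_vec_nth])
  moreover have "integrable \<Omega> (\<lambda>\<omega>. (w t \<omega> $ i)\<^sup>2)"
    unfolding power2_eq_square by (rule iid_noiseD(4)[OF noise])
  ultimately show ?thesis by (rule square_integrable_imp_integrable)
qed

text \<open>At distinct times, independence factors the expectation into means, which are 0.
  \<open>has_bochner_integral\<close> records integrability together with the value.\<close>

lemma noise_product: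
  assumes noise: "iid_noise \<Omega> w \<Sigma>"
  shows "has_bochner_integral \<Omega> (\<lambda>\<omega>. w s \<omega> $ i * w t \<omega> $ j) (if s = t then \<Sigma> $ i $ j else 0)"
proof (cases "s = t")
  case True
  then show ?thesis by (simp add: has_bochner_integral_iff iid_noiseD(4,5)[OF noise])
next
  case False
  interpret prob_space \<Omega> by (rule iid_noiseD(1)[OF noise])
  \<comment> \<open>Selecting a coordinate by time makes the product over the family indexed by
    \<open>{s, t}\<close> the required one.\<close>
  let ?k = "\<lambda>r. if r = s then i else j"
  have "indep_vars (\<lambda>_. borel) (\<lambda>r \<omega>. w r \<omega> $ ?k r) {s, t}"
    by (rule indep_vars_compose2[OF indep_vars_subset[OF iid_noiseD(2)[OF noise]], where Y = "\<lambda>r x. x $ ?k r"])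
      (simp_all add: borel_measurable_vec_nth)
  from indep_vars_integrable[OF _ this] indep_vars_lebesgue_integral[OF _ this]
  show ?thesis
    using False noise_integrable[OF noise] iid_noiseD(3)[OF noise]
    by (simp add: has_bochner_integral_iff)
qed

lemma consensus_Suc_nth:
  "consensus P x0 w (Suc t) \<omega> $ i = (\<Sum>k\<in>UNIV. P $ i $ k * consensus P x0 w t \<omega> $ k) + w t \<omega> $ i"
  by (simp add: matrix_vector_mult_def)

text \<open>The state at time \<open>t\<close> is built linearly from the initial state and noise at
  times before \<open>t\<close>, so uncorrelatedness with the noise at \<open>s\<close> propagates
  by linearity.\<close>

lemma consensus_noise_uncorrelated:
  assumes noise: "iid_noise \<Omega> w \<Sigma>"
  shows "t \<le> s \<Longrightarrow> has_bochner_integral \<Omega> (\<lambda>\<omega>. consensus P x0 w t \<omega> $ i * w s \<omega> $ j) 0"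
proof (induction t arbitrary: i)
  case 0
  show ?case by (simp add: has_bochner_integral_iff noise_integrable[OF noise] iid_noiseD(3)[OF noise])
next
  case (Suc t)
  let ?x = "\<lambda>k \<omega>. consensus P x0 w t \<omega> $ k"
  have x: "has_bochner_integral \<Omega> (\<lambda>\<omega>. ?x k \<omega> * w s \<omega> $ j) 0" for k
    using Suc.prems by (intro Suc.IH) simp
  have w: "has_bochner_integral \<Omega> (\<lambda>\<omega>. w t \<omega> $ i * w s \<omega> $ j) 0"
    using noise_product[OF noise, of t i s j] Suc.prems by simp
  have "has_bochner_integral \<Omega>
      (\<lambda>\<omega>. (\<Sum>k\<in>UNIV. P $ i $ k * (?x k \<omega> * w s \<omega> $ j)) + w t \<omega> $ i * w s \<omega> $ j)
      ((\<Sum>k\<in>UNIV. P $ i $ k * 0) + 0)"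
    by (intro has_bochner_integral_add has_bochner_integral_sum has_bochner_integral_mult_right x w)
  then show ?case
    unfolding consensus_Suc_nth by (simp add: distrib_right sum_distrib_right mult.assoc)
qed

lemma consensus_second_moment:
  assumes noise: "iid_noise \<Omega> w \<Sigma>"
  shows "has_bochner_integral \<Omega> (\<lambda>\<omega>. consensus P x0 w t \<omega> $ i * consensus P x0 w t \<omega> $ j)
    (second_moment P x0 \<Sigma> t $ i $ j)"
proof (induction t arbitrary: i j)
  case 0
  interpret prob_space \<Omega> by (rule iid_noiseD(1)[OF noise])
  show ?case by (simp add: has_bochner_integral_iff prob_space)
next
  case (Suc t)
  let ?x = "\<lambda>k \<omega>. consensus P x0 w t \<omega> $ k" and ?C = "second_moment P x0 \<Sigma> t"
  have w: "has_bochner_integral \<Omega> (\<lambda>\<omega>. w t \<omega> $ i * w t \<omega> $ j) (\<Sigma> $ i $ j)"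
    using noise_product[OF noise, of t i t j] by simp
  \<comment> \<open>Expansion of the product of two updated coordinates; the two mixed terms have
    mean 0.\<close>
  have "has_bochner_integral \<Omega>
      (\<lambda>\<omega>. (\<Sum>k\<in>UNIV. \<Sum>l\<in>UNIV. P $ i $ k * P $ j $ l * (?x k \<omega> * ?x l \<omega>))
        + (\<Sum>k\<in>UNIV. P $ i $ k * (?x k \<omega> * w t \<omega> $ j))
        + (\<Sum>l\<in>UNIV. P $ j $ l * (?x l \<omega> * w t \<omega> $ i))
        + w t \<omega> $ i * w t \<omega> $ j)
      ((\<Sum>k\<in>UNIV. \<Sum>l\<in>UNIV. P $ i $ k * P $ j $ l * ?C $ k $ l)
        + (\<Sum>k\<in>UNIV. P $ i $ k * 0) + (\<Sum>l\<in>UNIV. P $ j $ l * 0) + \<Sigma> $ i $ j)"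
    by (intro has_bochner_integral_add has_bochner_integral_sum has_bochner_integral_mult_right
        Suc consensus_noise_uncorrelated[OF noise order_refl] w)
  moreover have "(\<Sum>k\<in>UNIV. \<Sum>l\<in>UNIV. P $ i $ k * P $ j $ l * (?x k \<omega> * ?x l \<omega>))
        + (\<Sum>k\<in>UNIV. P $ i $ k * (?x k \<omega> * w t \<omega> $ j))
        + (\<Sum>l\<in>UNIV. P $ j $ l * (?x l \<omega> * w t \<omega> $ i))
        + w t \<omega> $ i * w t \<omega> $ j =
      consensus P x0 w (Suc t) \<omega> $ i * consensus P x0 w (Suc t) \<omega> $ j" for \<omega>
  proof -
    have "(\<Sum>k\<in>UNIV. \<Sum>l\<in>UNIV. P $ i $ k * P $ j $ l * (?x k \<omega> * ?x l \<omega>)) =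
        (\<Sum>k\<in>UNIV. P $ i $ k * ?x k \<omega>) * (\<Sum>l\<in>UNIV. P $ j $ l * ?x l \<omega>)"
      unfolding sum_product by (intro sum.cong refl) (simp add: mult_ac)
    moreover have "(\<Sum>k\<in>UNIV. P $ i $ k * (?x k \<omega> * w t \<omega> $ j)) =
        (\<Sum>k\<in>UNIV. P $ i $ k * ?x k \<omega>) * w t \<omega> $ j" for i j
      by (simp add: sum_distrib_right mult.assoc)
    ultimately show ?thesis unfolding consensus_Suc_nth by (simp add: algebra_simps)
  qed
  ultimately show ?case by (simp add: congruence_nth)
qed

text \<open>Entrywise pairing of \<open>C\<close> with the matrix of \<pi>-weighted deviations of an
  even power. At \<open>s = 0\<close> and \<open>C\<close> the moment matrix of a vector, it is the
  \<pi>-weighted variance of the coordinates. Powers are even because a congruence by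
  \<open>P\<close> contributes one factor on each side.\<close>

definition weighted_deviation ::
  "real^'n^'n \<Rightarrow> real^'n \<Rightarrow> nat \<Rightarrow> real^'n^'n \<Rightarrow> real" where
  "weighted_deviation P \<pi> s C =
    (\<Sum>i\<in>UNIV. \<Sum>j\<in>UNIV. \<pi> $ i * (matrix_power P (2 * s) $ i $ j - \<pi> $ j) * C $ i $ j)"

lemma weighted_deviation_add:
  "weighted_deviation P \<pi> s (C + D) = weighted_deviation P \<pi> s C + weighted_deviation P \<pi> s D"
  by (simp add: weighted_deviation_def distrib_left sum.distrib)

lemma sum_rotate:
  "(\<Sum>i\<in>A. \<Sum>j\<in>B. \<Sum>k\<in>C. f i j k) = (\<Sum>k\<in>C. \<Sum>i\<in>A. \<Sum>j\<in>B. f i j k)"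
  by (rule trans[OF sum.cong[OF refl sum.swap] sum.swap])

text \<open>The congruence moves from \<open>C\<close> to the coefficients. Reversibility turns the
  transposed left factor into \<open>P\<close> behind the weights, raising the power by two;
  stationarity leaves the subtracted products of \<pi> unchanged.\<close>

lemma weighted_deviation_congruence:
  assumes stat: "stationary_distribution P \<pi>" and rev: "reversible_wrt P \<pi>"
  shows "weighted_deviation P \<pi> s (P ** C ** transpose P) = weighted_deviation P \<pi> (Suc s) C"
proof -
  let ?Q = "matrix_power P (2 * s)" and ?R = "matrix_power P (2 * Suc s)"
  have R: "?R = P ** ?Q ** P"
    using matrix_power_Suc[of P "Suc (2 * s)"] matrix_power_Suc_right[of P "2 * s"]
    by (simp add: matrix_mul_assoc)
  have coeff: "(\<Sum>i\<in>UNIV. \<Sum>j\<in>UNIV. \<pi> $ i * (?Q $ i $ j - \<pi> $ j) * (P $ i $ k * P $ j $ l)) =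
      \<pi> $ k * (?R $ k $ l - \<pi> $ l)" for k l
  proof -
    have "(\<Sum>i\<in>UNIV. \<Sum>j\<in>UNIV. \<pi> $ i * (?Q $ i $ j - \<pi> $ j) * (P $ i $ k * P $ j $ l)) =
        (\<Sum>i\<in>UNIV. \<Sum>j\<in>UNIV. \<pi> $ k * (P $ k $ i * ?Q $ i $ j * P $ j $ l)
          - (\<pi> $ i * P $ i $ k) * (\<pi> $ j * P $ j $ l))"
    proof (intro sum.cong refl)
      fix i j
      have "\<pi> $ i * P $ i $ k * (?Q $ i $ j * P $ j $ l) = \<pi> $ k * P $ k $ i * (?Q $ i $ j * P $ j $ l)"
        using rev unfolding reversible_wrt_def by metis
      then show "\<pi> $ i * (?Q $ i $ j - \<pi> $ j) * (P $ i $ k * P $ j $ l) =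
          \<pi> $ k * (P $ k $ i * ?Q $ i $ j * P $ j $ l) - (\<pi> $ i * P $ i $ k) * (\<pi> $ j * P $ j $ l)"
        by (simp add: algebra_simps)
    qed
    also have "\<dots> = \<pi> $ k * (\<Sum>i\<in>UNIV. \<Sum>j\<in>UNIV. P $ k $ i * ?Q $ i $ j * P $ j $ l)
        - (\<Sum>i\<in>UNIV. \<pi> $ i * P $ i $ k) * (\<Sum>j\<in>UNIV. \<pi> $ j * P $ j $ l)"
      unfolding sum_product by (simp only: sum_subtractf sum_distrib_left)
    also have "(\<Sum>i\<in>UNIV. \<Sum>j\<in>UNIV. P $ k $ i * ?Q $ i $ j * P $ j $ l) = ?R $ k $ l"
      unfolding R matrix_mult_nth sum_distrib_right by (rule sum.swap)
    finally show ?thesis by (simp add: stationary_sum[OF stat] right_diff_distrib)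
  qed
  have "weighted_deviation P \<pi> s (P ** C ** transpose P) =
      (\<Sum>i\<in>UNIV. \<Sum>j\<in>UNIV. \<Sum>k\<in>UNIV. \<Sum>l\<in>UNIV.
        \<pi> $ i * (?Q $ i $ j - \<pi> $ j) * (P $ i $ k * P $ j $ l) * C $ k $ l)"
    unfolding weighted_deviation_def congruence_nth by (simp add: sum_distrib_left mult.assoc)
  also have "\<dots> = (\<Sum>k\<in>UNIV. \<Sum>i\<in>UNIV. \<Sum>j\<in>UNIV. \<Sum>l\<in>UNIV.
        \<pi> $ i * (?Q $ i $ j - \<pi> $ j) * (P $ i $ k * P $ j $ l) * C $ k $ l)"
    by (rule sum_rotate)
  also have "\<dots> = (\<Sum>k\<in>UNIV. \<Sum>l\<in>UNIV. \<Sum>i\<in>UNIV. \<Sum>j\<in>UNIV.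
        \<pi> $ i * (?Q $ i $ j - \<pi> $ j) * (P $ i $ k * P $ j $ l) * C $ k $ l)"
    by (rule sum.cong[OF refl sum_rotate])
  also have "\<dots> = weighted_deviation P \<pi> (Suc s) C"
    unfolding weighted_deviation_def coeff[symmetric] sum_distrib_right ..
  finally show ?thesis .
qed

text \<open>The disagreement is the pairing at index 0 with the second moment. Unrolling the
  Lyapunov recursion trades each congruence for one index, so noise added \<open>s\<close> steps
  before the latest is paired at index \<open>s\<close>.\<close>

lemma disagreement_eq:
  fixes P :: "real^'n^'n"
  assumes stat: "stationary_distribution P \<pi>" and rev: "reversible_wrt P \<pi>"
    and noise: "iid_noise \<Omega> w \<Sigma>"
  shows "disagreement \<Omega> P \<pi> x0 w t =
    weighted_deviation P \<pi> t (\<chi> i j. x0 $ i * x0 $ j) + (\<Sum>s<t. weighted_deviation P \<pi> s \<Sigma>)"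
proof -
  have sum_pi: "(\<Sum>i\<in>UNIV. \<pi> $ i) = 1" using stat by (simp add: stationary_distribution_def)
  let ?C = "second_moment P x0 \<Sigma> t" and ?x = "\<lambda>k \<omega>. consensus P x0 w t \<omega> $ k"
  let ?q = "\<Sum>k\<in>UNIV. \<Sum>l\<in>UNIV. \<pi> $ k * \<pi> $ l * ?C $ k $ l"
  have error: "(\<integral>\<omega>. (consensus_error P \<pi> x0 w t \<omega> $ i)\<^sup>2 \<partial>\<Omega>) =
      ?C $ i $ i - 2 * (\<Sum>k\<in>UNIV. \<pi> $ k * ?C $ i $ k) + ?q" for i
  proof -
    have "has_bochner_integral \<Omega>
      (\<lambda>\<omega>. ?x i \<omega> * ?x i \<omega> - 2 * (\<Sum>k\<in>UNIV. \<pi> $ k * (?x i \<omega> * ?x k \<omega>))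
        + (\<Sum>k\<in>UNIV. \<Sum>l\<in>UNIV. \<pi> $ k * \<pi> $ l * (?x k \<omega> * ?x l \<omega>)))
      (?C $ i $ i - 2 * (\<Sum>k\<in>UNIV. \<pi> $ k * ?C $ i $ k) + ?q)"
      by (intro has_bochner_integral_add has_bochner_integral_diff has_bochner_integral_sum
          has_bochner_integral_mult_right consensus_second_moment[OF noise])
    moreover have "?x i \<omega> * ?x i \<omega> - 2 * (\<Sum>k\<in>UNIV. \<pi> $ k * (?x i \<omega> * ?x k \<omega>))
        + (\<Sum>k\<in>UNIV. \<Sum>l\<in>UNIV. \<pi> $ k * \<pi> $ l * (?x k \<omega> * ?x l \<omega>)) =
        (consensus_error P \<pi> x0 w t \<omega> $ i)\<^sup>2" for \<omega>
    proof -
      have "(\<Sum>k\<in>UNIV. \<Sum>l\<in>UNIV. \<pi> $ k * \<pi> $ l * (?x k \<omega> * ?x l \<omega>)) =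
          (\<Sum>k\<in>UNIV. \<pi> $ k * ?x k \<omega>) * (\<Sum>k\<in>UNIV. \<pi> $ k * ?x k \<omega>)"
        unfolding sum_product by (intro sum.cong refl) (simp add: mult_ac)
      moreover have "(\<Sum>k\<in>UNIV. \<pi> $ k * (?x i \<omega> * ?x k \<omega>)) = ?x i \<omega> * (\<Sum>k\<in>UNIV. \<pi> $ k * ?x k \<omega>)"
        by (simp add: sum_distrib_left mult_ac)
      ultimately show ?thesis
        by (simp add: consensus_error_def weighted_average_def power2_eq_square algebra_simps)
    qed
    ultimately show ?thesis by (simp add: has_bochner_integral_integral_eq)
  qed
  have "disagreement \<Omega> P \<pi> x0 w t =
      (\<Sum>i\<in>UNIV. \<pi> $ i * ?C $ i $ i - 2 * (\<Sum>k\<in>UNIV. \<pi> $ i * \<pi> $ k * ?C $ i $ k) + \<pi> $ i * ?q)"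
  proof -
    have "\<pi> $ i * (?C $ i $ i - 2 * (\<Sum>k\<in>UNIV. \<pi> $ k * ?C $ i $ k) + ?q) =
        \<pi> $ i * ?C $ i $ i - 2 * (\<pi> $ i * (\<Sum>k\<in>UNIV. \<pi> $ k * ?C $ i $ k)) + \<pi> $ i * ?q" for i
      by (simp only: distrib_left right_diff_distrib mult.left_commute)
    then show ?thesis
      unfolding disagreement_def error by (simp only: sum_distrib_left mult.assoc)
  qed
  \<comment> \<open>Since \<pi> has mass 1, the last two terms sum to \<open>- 2 * ?q\<close> and
    \<open>?q\<close>.\<close>
  also have "\<dots> = (\<Sum>i\<in>UNIV. \<pi> $ i * ?C $ i $ i) - ?q"
    by (simp add: sum.distrib sum_subtractf sum_distrib_left[symmetric] sum_distrib_right[symmetric] sum_pi)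
  also have "\<dots> = weighted_deviation P \<pi> 0 ?C"
  proof -
    have "(\<Sum>j\<in>UNIV. \<pi> $ i * ((mat 1 :: real^'n^'n) $ i $ j) * ?C $ i $ j) = \<pi> $ i * ?C $ i $ i" for i
      by (simp add: mat_def if_distrib if_distribR cong: if_cong)
    then show ?thesis
      by (simp add: weighted_deviation_def matrix_power_0 right_diff_distrib left_diff_distrib sum_subtractf)
  qed
  \<comment> \<open>The offset \<open>r\<close> is arbitrary because the induction step uses the
    hypothesis at \<open>Suc r\<close>; the chain then takes \<open>r\<close> to be 0.\<close>
  also have "weighted_deviation P \<pi> r (second_moment P x0 \<Sigma> t) =
      weighted_deviation P \<pi> (r + t) (\<chi> i j. x0 $ i * x0 $ j) + (\<Sum>s<t. weighted_deviation P \<pi> (r + s) \<Sigma>)" for r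
  proof (induction t arbitrary: r)
    case (Suc t)
    then show ?case
      by (simp add: weighted_deviation_add weighted_deviation_congruence[OF stat rev]
          sum.lessThan_Suc_shift del: sum.lessThan_Suc)
  qed simp
  finally show ?thesis by simp
qed

section \<open>Passage to the steady state and matrix form of the limit\<close>

theorem theorem1:
  fixes P \<Sigma> :: "real^'n^'n" and \<pi> x0 :: "real^'n"
    and \<Omega> :: "'a measure" and w :: "nat \<Rightarrow> 'a \<Rightarrow> real^'n"
  assumes "stochastic P" and "irreducible_matrix P" and "aperiodic_matrix P"
    and "stationary_distribution P \<pi>"
    and "reversible_wrt P \<pi>"
    and "iid_noise \<Omega> w \<Sigma>"
  shows "steady_state_disagreement \<Omega> P \<pi> x0 w =
    ereal (\<pi> \<bullet> ((hitting_matrix (P ** P) ** diag_matrix \<pi> ** \<Sigma> ** diag_matrix \<pi>) *v 1)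
      - trace (hitting_matrix (P ** P) ** diag_matrix \<pi> ** \<Sigma> ** diag_matrix \<pi>))"
proof -
  let ?M = "P ** P" and ?H = "hitting_matrix (P ** P)"
  note P = assms(1-3) and stat = assms(4) and rev = assms(5) and noise = assms(6)
  note M = stochastic_mult[OF P(1) P(1)]
  have pos: "0 < \<pi> $ j" for j by (rule reversible_irreducible_pos[OF P(1,2) stat rev])
  have statM: "stationary_distribution ?M \<pi>"
    using stationary_power[OF stat, of 2] by (simp add: matrix_power_def numeral_2_eq_2)
  have lim: "(\<lambda>t. matrix_power P (2 * t) $ i $ j) \<longlonglongrightarrow> \<pi> $ j" for i j
    using LIMSEQ_subseq_LIMSEQ[OF reversible_power_tendsto[OF P stat rev], of "\<lambda>t. 2 * t" i j]
    by (simp add: strict_mono_def comp_def)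
  \<comment> \<open>\<open>G\<close> is the deviation matrix of \<open>?M\<close>, the sum of all
    deviations of its powers from the stationary rows. It comes from the telescoped sums with the
    leading power replaced by its limit.\<close>
  define G where "G i j = \<pi> $ j * ((\<Sum>k\<in>UNIV. \<pi> $ k * ?H $ k $ j) - ?H $ i $ j)" for i j
  have "(\<lambda>t. \<pi> $ j * ((\<Sum>k\<in>UNIV. matrix_power P (2 * t) $ i $ k * ?H $ k $ j) - ?H $ i $ j))
      \<longlonglongrightarrow> G i j" for i j
    unfolding G_def by (intro tendsto_intros lim)
  then have G: "(\<lambda>t. \<Sum>s<t. matrix_power P (2 * s) $ i $ j - \<pi> $ j) \<longlonglongrightarrow> G i j" for i j
    using sum_power_deviation[OF M irreducible_square[OF P] statM pos]
    by (simp add: matrix_power_square matrix_mult_nth)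
  have "(\<lambda>t. weighted_deviation P \<pi> t C) \<longlonglongrightarrow>
      (\<Sum>i\<in>UNIV. \<Sum>j\<in>UNIV. \<pi> $ i * (\<pi> $ j - \<pi> $ j) * C $ i $ j)" for C
    unfolding weighted_deviation_def by (intro tendsto_intros lim)
  then have initial: "(\<lambda>t. weighted_deviation P \<pi> t C) \<longlonglongrightarrow> 0" for C by simp
  have "(\<Sum>s<t. weighted_deviation P \<pi> s \<Sigma>) = (\<Sum>i\<in>UNIV. \<Sum>j\<in>UNIV.
      \<pi> $ i * (\<Sum>s<t. matrix_power P (2 * s) $ i $ j - \<pi> $ j) * \<Sigma> $ i $ j)" for t
    unfolding weighted_deviation_def
    by (simp only: sum_distrib_left sum_distrib_right sum.swap[of _ _ "{..<t}"])
  then have "(\<lambda>t. \<Sum>s<t. weighted_deviation P \<pi> s \<Sigma>) \<longlonglongrightarrow>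
      (\<Sum>i\<in>UNIV. \<Sum>j\<in>UNIV. \<pi> $ i * G i j * \<Sigma> $ i $ j)"
    by (simp only:) (intro tendsto_intros G)
  from tendsto_add[OF initial this]
  have limit: "(\<lambda>t. disagreement \<Omega> P \<pi> x0 w t) \<longlonglongrightarrow>
      (\<Sum>i\<in>UNIV. \<Sum>j\<in>UNIV. \<pi> $ i * G i j * \<Sigma> $ i $ j)"
    unfolding disagreement_eq[OF stat rev noise] by simp
  \<comment> \<open>Symmetry of \<Sigma> is read off from the noise moments. It is needed because
    the matrix product in the claim meets \<Sigma> with its indices in the opposite order from the
    pairing.\<close>
  have "\<Sigma> $ i $ j = (\<integral>\<omega>. w 0 \<omega> $ i * w 0 \<omega> $ j \<partial>\<Omega>)" for i j
    by (rule iid_noiseD(5)[OF noise, symmetric])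
  then have sym: "\<Sigma> $ i $ j = \<Sigma> $ j $ i" for i j
    by (simp add: mult.commute)
  let ?A = "?H ** diag_matrix \<pi> ** \<Sigma> ** diag_matrix \<pi>"
  have A: "?A $ i $ k = (\<Sum>j\<in>UNIV. ?H $ i $ j * \<pi> $ j * \<Sigma> $ j $ k) * \<pi> $ k" for i k
    unfolding matrix_mult_nth
    by (simp add: diag_matrix_def if_distrib if_distribR cong: if_cong)
  have "\<pi> \<bullet> (?A *v 1) = (\<Sum>k\<in>UNIV. \<Sum>j\<in>UNIV. \<pi> $ k * (\<pi> $ j * (\<Sum>i\<in>UNIV. \<pi> $ i * ?H $ i $ j)) * \<Sigma> $ k $ j)"
  proof -
    have "\<pi> \<bullet> (?A *v 1) = (\<Sum>i\<in>UNIV. \<Sum>k\<in>UNIV. \<Sum>j\<in>UNIV.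
        \<pi> $ k * (\<pi> $ j * (\<pi> $ i * ?H $ i $ j)) * \<Sigma> $ k $ j)"
      unfolding inner_vec_def matrix_vector_mult_def vec_lambda_beta A inner_real_def
        sum_distrib_left sum_distrib_right one_index
      by (intro sum.cong refl) (simp add: sym mult_ac)
    also have "\<dots> = (\<Sum>k\<in>UNIV. \<Sum>j\<in>UNIV. \<Sum>i\<in>UNIV. \<pi> $ k * (\<pi> $ j * (\<pi> $ i * ?H $ i $ j)) * \<Sigma> $ k $ j)"
      by (rule sum_rotate[symmetric])
    finally show ?thesis unfolding sum_distrib_left sum_distrib_right .
  qed
  moreover have "trace ?A = (\<Sum>k\<in>UNIV. \<Sum>j\<in>UNIV. \<pi> $ k * (\<pi> $ j * ?H $ k $ j) * \<Sigma> $ k $ j)"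
    unfolding trace_def A sum_distrib_right by (intro sum.cong refl) (simp add: sym mult_ac)
  ultimately have "(\<Sum>i\<in>UNIV. \<Sum>j\<in>UNIV. \<pi> $ i * G i j * \<Sigma> $ i $ j) = \<pi> \<bullet> (?A *v 1) - trace ?A"
    unfolding G_def by (simp only: sum_subtractf[symmetric] right_diff_distrib left_diff_distrib)
  \<comment> \<open>The disagreement converges, so its limsup is the limit.\<close>
  then show ?thesis
    unfolding steady_state_disagreement_def using limit
    by (intro lim_imp_Limsup) simp_all
qed

end
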